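(* For positive integers $t<k$ let $$W(k,t)=\left(1+\frac{(4k-3)t}{(2k-1)^2}\right)+\frac{1}{3}\left(1-\frac{(4k-3)t}{(2k-1)^2}\right)^{3/2}.$$ For all positive integers $t<k$ there exists an integer $D$ such that every $t$-quasi-linear hypergraph $\mathcal{H}$ with $r(\mathcal{H})=k$ and $\Delta(\mathcal{H})\ge D$ satisfies $$\chi_I(\mathcal{H})\le W(k,t)\, r(\mathcal{H})\,\Delta(\mathcal{H}).$$ In particular, for every $\varepsilon>0$ there exists $\eta>0$ such that for all positive integers $t,k$ with $t\le\eta k$ there exists an integer $D'$ such that every $t$-quasi-linear hypergraph $\mathcal{H}$ with $r(\mathcal{H})=k$ and $\Delta(\mathcal{H})\ge D'$ satisfies $\chi_I(\mathcal{H})\le \left(\frac43+\varepsilon\right)r(\mathcal{H})\Delta(\mathcal{H})$.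
   Context: A (finite) hypergraph $\mathcal{H}=(X,S)$ consists of a vertex set $X$ and a set $S$ of non-empty subsets of $X$ (edges). The degree of $x\in X$ is $|\{s\in S: x\in s\}|$; $\Delta(\mathcal{H})$ is the maximum degree and $r(\mathcal{H})=\max\{|s|: s\in S\}$. $\mathcal{H}$ is $t$-quasi-linear if $|s\cap s'|\le t$ for every two distinct edges $s,s'\in S$, and $|\{s\in S:\{x,x'\}\subseteq s\}|\le t$ for every two distinct vertices $x,x'\in X$. An incidence of $\mathcal{H}$ is a pair $(x,s)$ with $x\in X$, $s\in S$, $x\in s$. Two distinct incidences $(x,s)$ and $(x',s')$ are adjacent if $x=x'$, or $\{x,x'\}\subseteq s$, or $\{x,x'\}\subseteq s'$. A proper incidence $k$-coloring is a map from the set of incidences to $\{1,\dots,k\}$ giving distinct values to any two adjacent incidences; $\chi_I(\mathcal{H})$ is the minimum $k$ for which such a coloring exists. *)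

theory Defs
  imports Complex_Main
begin

locale hypergraph =
  fixes X :: "'a set" and S :: "'a set set"
  assumes finite_vertices: "finite X"
    and edges_subset: "\<And>s. s \<in> S \<Longrightarrow> s \<subseteq> X"
    and edges_nonempty: "\<And>s. s \<in> S \<Longrightarrow> s \<noteq> {}"

definition vertex_degree :: "'a set set \<Rightarrow> 'a \<Rightarrow> nat" where
  "vertex_degree S x = card {s \<in> S. x \<in> s}"

text \<open>The \<open>insert 0\<close> only fixes the value 0 for the maxima over an empty family.\<close>

definition max_degree :: "'a set \<Rightarrow> 'a set set \<Rightarrow> nat" where
  "max_degree X S = Max (insert 0 (vertex_degree S ` X))"

definition edge_rank :: "'a set set \<Rightarrow> nat" where
  "edge_rank S = Max (insert 0 (card ` S))"

definition quasi_linear :: "nat \<Rightarrow> 'a set \<Rightarrow> 'a set set \<Rightarrow> bool" where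
  "quasi_linear t X S \<longleftrightarrow>
     (\<forall>s\<in>S. \<forall>s'\<in>S. s \<noteq> s' \<longrightarrow> card (s \<inter> s') \<le> t) \<and>
     (\<forall>x\<in>X. \<forall>x'\<in>X. x \<noteq> x' \<longrightarrow> card {s \<in> S. {x, x'} \<subseteq> s} \<le> t)"

definition incidences :: "'a set \<Rightarrow> 'a set set \<Rightarrow> ('a \<times> 'a set) set" where
  "incidences X S = {(x, s). x \<in> X \<and> s \<in> S \<and> x \<in> s}"

fun incidence_adj :: "'a \<times> 'a set \<Rightarrow> 'a \<times> 'a set \<Rightarrow> bool" where
  "incidence_adj (x, s) (x', s') \<longleftrightarrow>
     (x, s) \<noteq> (x', s') \<and> (x = x' \<or> {x, x'} \<subseteq> s \<or> {x, x'} \<subseteq> s')"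

definition proper_incidence_coloring ::
  "'a set \<Rightarrow> 'a set set \<Rightarrow> nat \<Rightarrow> ('a \<times> 'a set \<Rightarrow> nat) \<Rightarrow> bool" where
  "proper_incidence_coloring X S k c \<longleftrightarrow>
     c ` incidences X S \<subseteq> {1..k} \<and>
     (\<forall>i\<in>incidences X S. \<forall>j\<in>incidences X S. incidence_adj i j \<longrightarrow> c i \<noteq> c j)"

definition incidence_chromatic_number :: "'a set \<Rightarrow> 'a set set \<Rightarrow> nat" where
  "incidence_chromatic_number X S = (LEAST k. \<exists>c. proper_incidence_coloring X S k c)"

definition W :: "nat \<Rightarrow> nat \<Rightarrow> real" where
  "W k t =
     (1 + (4 * real k - 3) * real t / (2 * real k - 1)\<^sup>2) +
     1 / 3 * (1 - (4 * real k - 3) * real t / (2 * real k - 1)\<^sup>2) powr (3 / 2)"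

end

theory Submission
  imports Defs "HOL-Library.FuncSet" "HOL-Library.Disjoint_Sets"
begin

text \<open>
  The bound is far from tight for fixed \<open>k\<close> and \<open>t\<close> and large maximum degree \<open>\<Delta>\<close>: already
  \<open>8 * (\<Delta> div 3)\<close> colours suffice, however large \<open>k\<close> is, while \<open>W k t * k \<ge> 8 / 3\<close> whenever
  \<open>0 < t < k\<close>, and \<open>(4 / 3 + \<epsilon>) * k \<ge> 8 / 3\<close> whenever \<open>k \<ge> 2\<close>. The second half of the theorem
  thus holds with \<open>\<eta> = 1 / 2\<close>, a value that only serves to force \<open>k \<ge> 2\<close>.

  For the colouring, put \<open>u = \<Delta> div 3\<close>. Colour the vertices with \<open>O((k \<Delta>)\<^sup>2)\<close> types so that
  the vertices of all edges through a common vertex have different types, and let a 0/1 matrix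
  have the types as rows and \<open>4 * u\<close> columns. A colour is a column together with a bit. An incidence
  \<open>(x, s)\<close> may use the column \<open>c\<close> if the bit of \<open>x\<close> in \<open>c\<close> differs from the bits of all other
  vertices of \<open>s\<close>, and its colour is then \<open>c\<close> with the bit of \<open>x\<close>. If two
  adjacent incidences belong to different vertices, then both vertices lie in the edge of one of the
  two incidences, so equal columns come with different bits. What remains is
  to give different columns to the edges at one vertex \<open>x\<close>, a separate matching problem for every
  \<open>x\<close>: at most \<open>3 * u + 2\<close> edges compete for \<open>4 * u\<close> columns.

  This matching exists as soon as every edge at \<open>x\<close> has many admissible columns and, for every large
  set \<open>A\<close> of edges at \<open>x\<close>, only few columns are inadmissible for all of \<open>A\<close>: an edge that cannot be
  matched directly takes the column of another edge, which moves to a free one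
  (\<open>matching_by_augmentation\<close>). Quasi-linearity is used here: since two vertices lie in at most \<open>t\<close>
  common edges, a large set \<open>A\<close> contains \<open>m\<close> edges that meet only in \<open>x\<close>
  (\<open>exists_disjoint_subfamily\<close>), and a random column is inadmissible for all of these with
  probability at most \<open>2 * (1 - 1 / 2 ^ k) ^ m\<close>, which is small when \<open>m\<close> is a large constant.

  Both requirements concern the matrix alone, and there are only polynomially many instances of
  them in \<open>u\<close> (constantly many types are involved in each), while each fails for a random matrix
  with a probability exponentially small in \<open>u\<close>. Hence a single matrix satisfies all of them once
  \<open>u\<close> is large (\<open>eventually_exists_separating_columns\<close>); it serves all hypergraphs with this \<open>u\<close>,
  whatever their number of vertices.
\<close>

section \<open>Hitting and separating random sets\<close>

text \<open>
  A random subset of \<open>I\<close> misses a given block of size at most \<open>k\<close> with probability at least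
  \<open>1 / 2 ^ k\<close>, and disjoint blocks behave independently: the induction splits off one block \<open>J\<close> and
  identifies \<open>T\<close> with the pair of \<open>T \<inter> J\<close> and \<open>T - J\<close>.
\<close>
lemma card_hitting_subsets:
  assumes "finite F" "finite I" "disjoint F" "\<Union>F \<subseteq> I" "\<And>J. J \<in> F \<Longrightarrow> card J \<le> k"
  shows "real (card {T \<in> Pow I. \<forall>J\<in>F. T \<inter> J \<noteq> {}}) \<le> (1 - 1 / 2 ^ k) ^ card F * 2 ^ card I"
  using assms
proof (induction F arbitrary: I rule: finite_induct)
  case empty
  then show ?case by (simp flip: Pow_def add: card_Pow)
next
  case (insert J F)
  let ?A = "{T \<in> Pow (I - J). \<forall>J'\<in>F. T \<inter> J' \<noteq> {}}"
  let ?L = "{T \<in> Pow I. \<forall>J'\<in>insert J F. T \<inter> J' \<noteq> {}}"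
  have J: "J \<subseteq> I" and fJ: "finite J" and kJ: "card J \<le> k"
    using insert.prems finite_subset by auto
  have dis: "J' \<inter> J = {}" if "J' \<in> F" for J'
    using insert.prems(2) insert.hyps(2) that by (auto simp: disjoint_def)
  have IH: "real (card ?A) \<le> (1 - 1 / 2 ^ k) ^ card F * 2 ^ card (I - J)"
  proof (rule insert.IH)
    show "disjoint F" using insert.prems(2) by (auto simp: disjoint_def)
    show "\<Union>F \<subseteq> I - J" using insert.prems(3) dis by blast
  qed (use insert.prems in auto)
  have "card ?L \<le> card ((Pow J - {{}}) \<times> ?A)"
  proof (rule card_inj_on_le[where f = "\<lambda>T. (T \<inter> J, T - J)"])
    show "inj_on (\<lambda>T. (T \<inter> J, T - J)) ?L" by (auto simp: inj_on_def)
    show "(\<lambda>T. (T \<inter> J, T - J)) ` ?L \<subseteq> (Pow J - {{}}) \<times> ?A"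
    proof (safe)
      fix T J' x
      assume T: "T \<subseteq> I" "\<forall>J'\<in>insert J F. T \<inter> J' \<noteq> {}" "J' \<in> F" "(T - J) \<inter> J' = {}"
      then obtain y where "y \<in> T" "y \<in> J'" by blast
      then show False using dis[OF T(3)] T(4) by blast
    qed auto
    show "finite ((Pow J - {{}}) \<times> ?A)" using fJ insert.prems(1) by auto
  qed
  also have "\<dots> = (2 ^ card J - 1) * card ?A"
    using fJ by (simp add: card_cartesian_product card_Diff_singleton card_Pow)
  finally have "real (card ?L) \<le> real ((2 ^ card J - 1) * card ?A)"
    by (rule of_nat_mono)
  then have 1: "real (card ?L) \<le> (2 ^ card J - 1) * real (card ?A)"
    by (simp add: of_nat_diff)
  have 2: "(2 ^ card J - 1 :: real) \<le> (1 - 1 / 2 ^ k) * 2 ^ card J"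
    using power_increasing[OF kJ, of "2::real"] by (simp add: field_simps)
  have "real (card ?L) \<le> ((1 - 1 / 2 ^ k) * 2 ^ card J) * ((1 - 1 / 2 ^ k) ^ card F * 2 ^ card (I - J))"
    by (rule order_trans[OF 1], rule mult_mono[OF 2 IH]) auto
  also have "(2::real) ^ card J * 2 ^ card (I - J) = 2 ^ card I"
    using J fJ insert.prems(1) by (simp add: card_Diff_subset card_mono flip: power_add)
  then have "((1 - 1 / 2 ^ k) * 2 ^ card J) * ((1 - 1 / 2 ^ k) ^ card F * 2 ^ card (I - J))
     = (1 - 1 / 2 ^ k) ^ card (insert J F) * (2::real) ^ card I"
    using insert.hyps by (simp add: mult_ac)
  finally show ?case .
qed

text \<open>
  Complementation in \<open>I\<close> turns the sets that contain no block into those that meet every block.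
\<close>
lemma card_missing_subsets:
  assumes "finite F" "finite I" "disjoint F" "\<Union>F \<subseteq> I" "\<And>J. J \<in> F \<Longrightarrow> card J \<le> k"
  shows "real (card {T \<in> Pow I. \<forall>J\<in>F. J - T \<noteq> {}}) \<le> (1 - 1 / 2 ^ k) ^ card F * 2 ^ card I"
proof -
  have "card {T \<in> Pow I. \<forall>J\<in>F. J - T \<noteq> {}} \<le> card {T \<in> Pow I. \<forall>J\<in>F. T \<inter> J \<noteq> {}}"
  proof (rule card_inj_on_le[where f = "\<lambda>T. I - T"])
    show "inj_on ((-) I) {T \<in> Pow I. \<forall>J\<in>F. J - T \<noteq> {}}" by (auto simp: inj_on_def)
    show "(-) I ` {T \<in> Pow I. \<forall>J\<in>F. J - T \<noteq> {}} \<subseteq> {T \<in> Pow I. \<forall>J\<in>F. T \<inter> J \<noteq> {}}"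
      using assms(4) by blast
  qed (use assms in auto)
  then show ?thesis
    using card_hitting_subsets[OF assms] by (meson of_nat_mono order_trans)
qed

text \<open>
  The set \<open>T\<close> is a column of the matrix, given by the rows that have the bit 1. An incidence at a
  vertex of type \<open>i\<close> may use it if no type in \<open>J\<close>, the set of types of the other vertices of the edge,
  has the same bit as \<open>i\<close>.
\<close>
definition separates :: "'b set \<Rightarrow> 'b \<Rightarrow> 'b set \<Rightarrow> bool" where
  "separates T i J \<longleftrightarrow> (i \<in> T \<and> T \<inter> J = {}) \<or> (i \<notin> T \<and> J \<subseteq> T)"

text \<open>
  It suffices to count the separating sets with \<open>i \<in> T\<close>: they are free outside at most \<open>k + 1\<close>
  elements.
\<close>
lemma card_nonseparating_subsets:
  assumes "finite I" "i \<in> I" "J \<subseteq> I - {i}" "card J \<le> k"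
  shows "real (card {T \<in> Pow I. \<not> separates T i J}) \<le> (1 - 1 / 2 ^ Suc k) * 2 ^ card I"
proof -
  \<comment> \<open>the separating sets that contain \<open>i\<close>\<close>
  let ?B = "insert i ` Pow (I - insert i J)"
  have fJ: "finite J" using assms finite_subset by blast
  have iJ: "i \<notin> J" using assms by auto
  have cB: "card ?B = 2 ^ card (I - insert i J)"
    using assms(1) by (subst card_image) (auto simp: inj_on_def card_Pow)
  have B: "?B \<subseteq> Pow I" using assms by auto
  have "card {T \<in> Pow I. \<not> separates T i J} \<le> card (Pow I - ?B)"
    using assms(1) iJ by (intro card_mono) (auto simp: separates_def)
  also have "\<dots> = 2 ^ card I - 2 ^ card (I - insert i J)"
    using B assms(1) by (simp add: card_Diff_subset finite_subset card_Pow cB)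
  finally have "real (card {T \<in> Pow I. \<not> separates T i J}) \<le> real (2 ^ card I - 2 ^ card (I - insert i J))"
    by (rule of_nat_mono)
  also have "\<dots> = 2 ^ card I - 2 ^ card (I - insert i J)"
    using assms(1) by (simp add: card_mono of_nat_diff)
  finally have "real (card {T \<in> Pow I. \<not> separates T i J}) \<le> 2 ^ card I - 2 ^ card (I - insert i J)" .
  moreover have "card I \<le> card (I - insert i J) + Suc k"
    using diff_card_le_card_Diff[of "insert i J" I] assms(4) iJ fJ by simp
  then have "(2::real) ^ card I \<le> 2 ^ card (I - insert i J) * 2 ^ Suc k"
    unfolding power_add[symmetric] by (rule power_increasing) simp
  then have "(2::real) ^ card I / 2 ^ Suc k \<le> 2 ^ card (I - insert i J)"
    by (simp add: divide_le_eq)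
  ultimately show ?thesis by (simp add: left_diff_distrib)
qed

lemma card_small_subsets_le:
  assumes "finite I"
  shows "card {J. J \<subseteq> I \<and> card J \<le> k} \<le> (card I + 1) ^ k"
proof (induction k)
  case 0
  have "{J. J \<subseteq> I \<and> card J \<le> 0} = {{}}"
    using assms finite_subset by fastforce
  then show ?case by simp
next
  case (Suc k)
  let ?P = "\<lambda>k. {J. J \<subseteq> I \<and> card J \<le> k}"
  let ?Q = "insert {} ((\<lambda>x. {x}) ` I)"
  have fP: "finite (?P k)" using assms by auto
  have "?P (Suc k) \<subseteq> (\<lambda>(A, J). A \<union> J) ` (?Q \<times> ?P k)"
  proof
    fix J assume J: "J \<in> ?P (Suc k)"
    show "J \<in> (\<lambda>(A, J). A \<union> J) ` (?Q \<times> ?P k)"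
    proof (cases "J = {}")
      case True
      then show ?thesis by (intro image_eqI[of _ _ "({}, {})"]) auto
    next
      case False
      then obtain x where x: "x \<in> J" by blast
      have "card (J - {x}) \<le> k" "J - {x} \<subseteq> I" "x \<in> I"
        using J x by auto
      then have "({x}, J - {x}) \<in> ?Q \<times> ?P k" by auto
      moreover have "J = {x} \<union> (J - {x})" using x by auto
      ultimately show ?thesis by (intro image_eqI[of _ _ "({x}, J - {x})"]) auto
    qed
  qed
  then have "card (?P (Suc k)) \<le> card (?Q \<times> ?P k)"
    using fP assms by (intro surj_card_le) auto
  also have "\<dots> = card ?Q * card (?P k)" by (rule card_cartesian_product)
  also have "\<dots> \<le> (card I + 1) * (card I + 1) ^ k"
  proof (rule mult_mono)
    show "card ?Q \<le> card I + 1"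
      using assms card_image_le[of I "\<lambda>x. {x}"] by (auto simp: card_insert_if)
  qed (use Suc.IH in auto)
  finally show ?case by simp
qed

section \<open>Random columns and the union bound\<close>

text \<open>
  The exponential moment method with base 2, written as counting. Each choice \<open>G\<close> of \<open>n\<close> columns gets
  the weight \<open>2\<close> to the number of its columns in \<open>H\<close>; this weight is a product over the columns, so
  the total weight of all choices is \<open>(card \<Omega> + card H) ^ n\<close>.
\<close>
lemma card_frequent_columns:
  assumes "finite \<Omega>" "H \<subseteq> \<Omega>"
  shows "card {G \<in> {..<n::nat} \<rightarrow>\<^sub>E \<Omega>. s \<le> card {c \<in> {..<n}. G c \<in> H}} * 2 ^ s
           \<le> (card \<Omega> + card H) ^ n"
proof -
  let ?P = "{..<n} \<rightarrow>\<^sub>E \<Omega>"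
  let ?w = "\<lambda>a. if a \<in> H then 2 else (1::nat)"
  have fP: "finite ?P" using assms by (simp add: finite_PiE)
  have w: "(\<Prod>c<n. ?w (G c)) = 2 ^ card {c \<in> {..<n}. G c \<in> H}" for G
    by (simp add: prod.If_cases Int_def)
  have "card {G \<in> ?P. s \<le> card {c \<in> {..<n}. G c \<in> H}} * 2 ^ s
      = (\<Sum>G \<in> {G \<in> ?P. s \<le> card {c \<in> {..<n}. G c \<in> H}}. 2 ^ s)"
    by simp
  also have "\<dots> \<le> (\<Sum>G \<in> {G \<in> ?P. s \<le> card {c \<in> {..<n}. G c \<in> H}}. \<Prod>c<n. ?w (G c))"
    unfolding w by (intro sum_mono power_increasing) auto
  also have "\<dots> \<le> (\<Sum>G \<in> ?P. \<Prod>c<n. ?w (G c))"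
    using fP by (intro sum_mono2) auto
  also have "\<dots> = (\<Prod>c<n. \<Sum>a\<in>\<Omega>. ?w a)"
    by (rule prod_sum_PiE[symmetric]) (use assms in auto)
  also have "(\<Sum>a\<in>\<Omega>. ?w a) = (\<Sum>a\<in>\<Omega>. 1) + (\<Sum>a\<in>\<Omega>. if a \<in> H then 1 else 0)"
    unfolding sum.distrib[symmetric] by (rule sum.cong) auto
  also have "\<dots> = card \<Omega> + card H"
    using assms by (simp add: Int_absorb1 flip: sum.inter_restrict)
  finally show ?thesis by simp
qed

text \<open>
  The union bound: a pair \<open>(H, s)\<close> in \<open>HH\<close> stands for the bad event that at least \<open>s\<close> of the \<open>n\<close> random
  columns fall into \<open>H\<close>.
\<close>
lemma exists_columns_avoiding:
  fixes HH :: "('b set \<times> nat) set"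
  assumes "finite \<Omega>" "\<Omega> \<noteq> {}" "finite HH" "\<And>H s. (H, s) \<in> HH \<Longrightarrow> H \<subseteq> \<Omega>"
    and small: "(\<Sum>(H, s)\<in>HH. (1 + real (card H) / real (card \<Omega>)) ^ n / 2 ^ s) < 1"
  shows "\<exists>G \<in> {..<n::nat} \<rightarrow>\<^sub>E \<Omega>. \<forall>(H, s)\<in>HH. card {c \<in> {..<n}. G c \<in> H} < s"
proof (rule ccontr)
  let ?P = "{..<n} \<rightarrow>\<^sub>E \<Omega>"
  let ?Bad = "\<lambda>(H, s). {G \<in> ?P. s \<le> card {c \<in> {..<n}. G c \<in> H}}"
  let ?N = "real (card \<Omega>)"
  have N: "?N > 0" using assms by (simp add: card_gt_0_iff)
  have fP: "finite ?P" using assms by (simp add: finite_PiE)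
  have cP: "real (card ?P) = ?N ^ n" by (simp add: card_PiE)
  have bad: "real (card (?Bad h)) \<le> ?N ^ n * (case h of (H, s) \<Rightarrow> (1 + real (card H) / ?N) ^ n / 2 ^ s)"
    if "h \<in> HH" for h
  proof -
    obtain H s where h: "h = (H, s)" by force
    have "real (card (?Bad h) * 2 ^ s) \<le> real ((card \<Omega> + card H) ^ n)"
      using card_frequent_columns[OF assms(1) assms(4), of H s n s] that
      unfolding h of_nat_le_iff by simp
    then have "real (card (?Bad h)) \<le> (?N + real (card H)) ^ n / 2 ^ s"
      by (simp add: le_divide_eq)
    also have "?N + real (card H) = ?N * (1 + real (card H) / ?N)"
      using N by (simp add: distrib_left)
    finally show ?thesis
      by (simp add: h power_mult_distrib)
  qed
  assume "\<not> ?thesis"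
  then have ex: "\<exists>(H, s)\<in>HH. s \<le> card {c \<in> {..<n}. G c \<in> H}" if "G \<in> ?P" for G
    using that by (auto simp: not_less split: prod.splits)
  have "?P \<subseteq> (\<Union>h\<in>HH. ?Bad h)"
  proof
    fix G assume G: "G \<in> ?P"
    then obtain H s where "(H, s) \<in> HH" "s \<le> card {c \<in> {..<n}. G c \<in> H}"
      using ex[OF G] by auto
    then show "G \<in> (\<Union>h\<in>HH. ?Bad h)" using G by (intro UN_I[of "(H, s)"]) auto
  qed
  then have "card ?P \<le> card (\<Union>h\<in>HH. ?Bad h)"
    using fP assms(3) by (intro card_mono) auto
  also have "\<dots> \<le> (\<Sum>h\<in>HH. card (?Bad h))"
    by (rule card_UN_le[OF assms(3)])
  finally have "?N ^ n \<le> real (\<Sum>h\<in>HH. card (?Bad h))"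
    unfolding cP[symmetric] of_nat_le_iff .
  also have "\<dots> \<le> (\<Sum>h\<in>HH. ?N ^ n * (case h of (H, s) \<Rightarrow> (1 + real (card H) / ?N) ^ n / 2 ^ s))"
    unfolding of_nat_sum by (intro sum_mono bad)
  also have "\<dots> < ?N ^ n * 1"
    unfolding sum_distrib_left[symmetric] using N small by (intro mult_strict_left_mono) auto
  finally show False by simp
qed

text \<open>
  For \<open>p > 0\<close> the sequence is the \<open>p\<close>-th power of \<open>u / x ^ u\<close>, where \<open>x\<close> is the \<open>p\<close>-th root of \<open>1 / q\<close>.
\<close>
lemma power_times_geometric_tendsto_0:
  fixes q :: real
  assumes "0 < q" "q < 1"
  shows "(\<lambda>u. real u ^ p * q ^ u) \<longlonglongrightarrow> 0"
proof (cases "p = 0")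
  case True
  then show ?thesis using assms LIMSEQ_realpow_zero[of q] by simp
next
  case False
  let ?x = "root p (1 / q)"
  have "?x > 1" using False assms by simp
  then have "(\<lambda>u. real u / ?x ^ u) \<longlonglongrightarrow> 0"
    by (intro lim_n_over_pown) simp
  then have "(\<lambda>u. (real u / ?x ^ u) ^ p) \<longlonglongrightarrow> 0 ^ p"
    by (rule tendsto_power)
  moreover have "(real u / ?x ^ u) ^ p = real u ^ p * q ^ u" for u
  proof -
    have "(?x ^ u) ^ p = (?x ^ p) ^ u" by (simp add: mult.commute flip: power_mult)
    also have "?x ^ p = 1 / q" using False assms by simp
    finally show ?thesis by (simp add: power_divide)
  qed
  moreover have "(0::real) ^ p = 0" using False by (rule zero_power[OF neq0_conv[THEN iffD1]])
  ultimately show ?thesis by simp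
qed

text \<open>
  The polynomial is the one by which the number of bad events is bounded: there are at most
  \<open>(k * (3 * u + 2))\<^sup>2 + 1\<close> types.
\<close>
lemma eventually_polynomial_times_geometric_less:
  fixes q \<epsilon> :: real
  assumes "0 < q" "q < 1" "0 < \<epsilon>" "0 \<le> C"
  shows "\<forall>\<^sub>F u in sequentially. C * real ((k * (3 * u + 2))\<^sup>2 + 2) ^ p * q ^ u < \<epsilon>"
proof -
  let ?B = "real (5 * k + 2)"
  have "(\<lambda>u. (C * ?B ^ (2 * p)) * (real u ^ (2 * p) * q ^ u)) \<longlonglongrightarrow> (C * ?B ^ (2 * p)) * 0"
    by (intro tendsto_mult tendsto_const power_times_geometric_tendsto_0 assms)
  then have "\<forall>\<^sub>F u in sequentially. (C * ?B ^ (2 * p)) * (real u ^ (2 * p) * q ^ u) < \<epsilon>"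
    using assms(3) by (auto intro: order_tendstoD(2))
  then show ?thesis
    using eventually_ge_at_top[of "1::nat"]
  proof eventually_elim
    case (elim u)
    have "(k * (3 * u + 2))\<^sup>2 + 2 \<le> (5 * k * u)\<^sup>2 + (2 * u)\<^sup>2"
    proof (rule add_mono)
      have "k * (3 * u + 2) \<le> k * (5 * u)" using elim(2) by (intro mult_left_mono) auto
      then show "(k * (3 * u + 2))\<^sup>2 \<le> (5 * k * u)\<^sup>2" by (intro power_mono) (auto simp: mult_ac)
      have "1 * 1 \<le> u * u" using elim(2) by (intro mult_mono) auto
      then show "2 \<le> (2 * u)\<^sup>2" by (simp add: power2_eq_square)
    qed
    also have "\<dots> \<le> ((5 * k + 2) * u)\<^sup>2"
      by (simp add: power2_eq_square algebra_simps)
    finally have "real ((k * (3 * u + 2))\<^sup>2 + 2) \<le> real (((5 * k + 2) * u)\<^sup>2)"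
      by (rule of_nat_mono)
    then have "real ((k * (3 * u + 2))\<^sup>2 + 2) ^ p \<le> real (((5 * k + 2) * u)\<^sup>2) ^ p"
      by (intro power_mono) auto
    also have "\<dots> = ?B ^ (2 * p) * real u ^ (2 * p)"
      unfolding of_nat_power of_nat_mult power_mult_distrib power_mult ..
    finally have "C * real ((k * (3 * u + 2))\<^sup>2 + 2) ^ p * q ^ u
        \<le> C * (?B ^ (2 * p) * real u ^ (2 * p)) * q ^ u"
      using assms by (intro mult_right_mono mult_left_mono) auto
    then show ?case using elim(1) by (simp add: mult_ac)
  qed
qed

text \<open>
  The two kinds of bad events need different treatment. For a type \<open>i\<close> and a set \<open>J\<close>, a column fails
  to separate with a probability \<open>1 - 1 / 2 ^ (k + 1)\<close> close to 1, but it is enough to exclude that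
  all except \<open>K\<close> of the \<open>4 * u\<close> columns fail. For a family of \<open>m\<close> disjoint sets, a column can be
  inadmissible for all of them only if it meets every one of them or contains none of them, depending
  on the bit of the centre; by the choice of \<open>m\<close> this has probability at most \<open>1 / 8\<close>, so that even
  \<open>u - 1\<close> out of \<open>4 * u\<close> columns are exponentially unlikely, as \<open>(9 / 8) ^ 4 < 2\<close>.
\<close>
lemma eventually_exists_separating_columns:
  fixes k m K :: nat
  assumes m: "2 * (1 - 1 / 2 ^ k) ^ m \<le> (1 / 8 :: real)"
  shows "\<forall>\<^sub>F u in sequentially. \<forall>I :: nat set. finite I \<and> card I \<le> (k * (3 * u + 2))\<^sup>2 + 1 \<longrightarrow>
    (\<exists>T. (\<forall>i\<in>I. \<forall>J. J \<subseteq> I - {i} \<longrightarrow> card J \<le> k \<longrightarrow>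
            K \<le> card {c \<in> {..<4 * u}. separates (T c) i J}) \<and>
         (\<forall>F. disjoint F \<longrightarrow> \<Union>F \<subseteq> I \<longrightarrow> (\<forall>J\<in>F. card J \<le> k) \<longrightarrow> card F = m \<longrightarrow>
            card {c \<in> {..<4 * u}. (\<forall>J\<in>F. T c \<inter> J \<noteq> {}) \<or> (\<forall>J\<in>F. J - T c \<noteq> {})} \<le> u - 2))"
proof -
  \<comment> \<open>the decay per unit of \<open>u\<close> of the first kind of bad events; for the second it is \<open>(9 / 8) ^ 4 / 2 = 6561 / 8192\<close>\<close>
  define q where "q = (1 - 1 / 2 ^ (k + 2) :: real) ^ 4"
  have "(1::real) < 2 ^ (k + 2)" by (rule one_less_power) auto
  then have "0 < 1 - 1 / (2::real) ^ (k + 2)" "1 - 1 / (2::real) ^ (k + 2) < 1"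
    by (auto simp del: power_Suc power_add simp: divide_less_eq)
  then have q: "0 < q" "q < 1"
    unfolding q_def by (simp_all only: zero_less_power power_less_one_iff less_imp_le zero_less_numeral simp_thms)
  have ev1: "\<forall>\<^sub>F u in sequentially. 2 ^ K * real ((k * (3 * u + 2))\<^sup>2 + 2) ^ (k + 1) * q ^ u < 1 / 2"
    using q by (intro eventually_polynomial_times_geometric_less) auto
  have ev2: "\<forall>\<^sub>F u in sequentially. 2 * real ((k * (3 * u + 2))\<^sup>2 + 2) ^ (k * m) * (6561 / 8192) ^ u < 1 / 2"
    by (intro eventually_polynomial_times_geometric_less) auto
  show ?thesis
    using ev1 ev2 eventually_ge_at_top[of "max 2 K"]
  proof eventually_elim
    case (elim u)
    have u: "2 \<le> u" "K \<le> 4 * u" using elim(3) by auto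
    show ?case
    proof (intro allI impI, elim conjE)
      fix I :: "nat set"
      assume I: "finite I" "card I \<le> (k * (3 * u + 2))\<^sup>2 + 1"
      define N where "N = (k * (3 * u + 2))\<^sup>2 + 2"
      have N: "card I + 1 \<le> N" using I(2) by (simp add: N_def)
      define P where "P = {J. J \<subseteq> I \<and> card J \<le> k}"
      define H1 where "H1 = (\<lambda>(i, J). {T \<in> Pow I. \<not> separates T i J})"
      define H2 where "H2 = (\<lambda>F. {T \<in> Pow I. (\<forall>J\<in>F. T \<inter> J \<noteq> {}) \<or> (\<forall>J\<in>F. J - T \<noteq> {})})"
      define A1 where "A1 = {(i, J). i \<in> I \<and> J \<subseteq> I - {i} \<and> card J \<le> k}"
      define A2 where "A2 = {F. F \<subseteq> P \<and> card F = m \<and> disjoint F}"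
      define HH1 where "HH1 = (\<lambda>a. (H1 a, 4 * u - K + 1)) ` A1"
      define HH2 where "HH2 = (\<lambda>F. (H2 F, u - 1)) ` A2"
      define w :: "nat set set \<times> nat \<Rightarrow> real" where "w = (\<lambda>(H, s). (1 + real (card H) / real (card (Pow I))) ^ (4 * u) / 2 ^ s)"
      have fP: "finite P" and cP: "card P \<le> N ^ k"
        using I(1) card_small_subsets_le[OF I(1), of k] power_mono[OF N, of k] by (auto simp: P_def)
      have A1: "A1 \<subseteq> I \<times> P" by (auto simp: A1_def P_def)
      have fA1: "finite A1" using finite_subset[OF A1] I(1) fP by simp
      have A2: "A2 \<subseteq> {F. F \<subseteq> P \<and> card F = m}" by (auto simp: A2_def)
      have fA2: "finite A2" using finite_subset[OF A2] fP by simp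
      have "card A1 \<le> card I * card P"
        using card_mono[OF _ A1] I(1) fP by (simp add: card_cartesian_product)
      also have "\<dots> \<le> N * N ^ k" using N cP by (intro mult_mono) auto
      finally have cA1: "card A1 \<le> N ^ (k + 1)" by simp
      have "card A2 \<le> card P choose m"
        using card_mono[OF _ A2] fP by (simp add: n_subsets)
      also have "\<dots> \<le> card P ^ m"
        by (cases "m \<le> card P") (auto simp: binomial_le_pow binomial_eq_0)
      also have "\<dots> \<le> (N ^ k) ^ m" using cP by (rule power_mono) simp
      finally have cA2: "card A2 \<le> N ^ (k * m)" by (simp add: power_mult)
      have w1: "w h \<le> 2 ^ K * q ^ u" if h: "h \<in> HH1" for h
      proof -
        obtain i J where iJ: "h = (H1 (i, J), 4 * u - K + 1)" "i \<in> I" "J \<subseteq> I - {i}" "card J \<le> k"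
          using h by (auto simp: HH1_def A1_def)
        have "real (card (H1 (i, J))) / real (card (Pow I)) \<le> 1 - 1 / 2 ^ Suc k"
          using card_nonseparating_subsets[OF I(1) iJ(2-4)] I(1)
          by (simp add: H1_def card_Pow divide_le_eq)
        then have "1 + real (card (H1 (i, J))) / real (card (Pow I)) \<le> 2 * (1 - 1 / 2 ^ (k + 2))"
          by simp
        then have "(1 + real (card (H1 (i, J))) / real (card (Pow I))) ^ (4 * u)
            \<le> (2 * (1 - 1 / 2 ^ (k + 2))) ^ (4 * u)"
          by (intro power_mono) auto
        also have "\<dots> = 2 ^ (4 * u) * q ^ u"
          unfolding q_def power_mult_distrib power_mult[symmetric] ..
        also have "(2::real) ^ (4 * u) = 2 ^ K * 2 ^ (4 * u - K)"
          using u(2) by (simp flip: power_add)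
        also have "2 ^ K * 2 ^ (4 * u - K) * q ^ u \<le> 2 ^ K * 2 ^ (4 * u - K + 1) * q ^ u"
          using q by (intro mult_right_mono mult_left_mono power_increasing) auto
        finally show ?thesis
          unfolding iJ(1) w_def prod.case by (subst pos_divide_le_eq) (auto simp: mult_ac)
      qed
      have w2: "w h \<le> 2 * (6561 / 8192) ^ u" if h: "h \<in> HH2" for h
      proof -
        obtain F where F: "h = (H2 F, u - 1)" "F \<subseteq> P" "card F = m" "disjoint F"
          using h by (auto simp: HH2_def A2_def)
        have F': "finite F" "\<Union>F \<subseteq> I" "\<And>J. J \<in> F \<Longrightarrow> card J \<le> k"
          using finite_subset[OF F(2) fP] F(2) unfolding P_def by blast+
        let ?hit = "{T \<in> Pow I. \<forall>J\<in>F. T \<inter> J \<noteq> {}}" and ?miss = "{T \<in> Pow I. \<forall>J\<in>F. J - T \<noteq> {}}"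
        have "H2 F = ?hit \<union> ?miss" by (auto simp: H2_def)
        then have "real (card (H2 F)) \<le> real (card ?hit) + real (card ?miss)"
          using of_nat_mono[OF card_Un_le[of ?hit ?miss], where 'a = real] by simp
        also have "\<dots> \<le> (2 * (1 - 1 / 2 ^ k) ^ m) * 2 ^ card I"
          using card_hitting_subsets[OF F'(1) I(1) F(4) F'(2,3)]
            card_missing_subsets[OF F'(1) I(1) F(4) F'(2,3)] F(3) by simp
        also have "\<dots> \<le> 1 / 8 * 2 ^ card I" using m by (rule mult_right_mono) simp
        finally have "real (card (H2 F)) / real (card (Pow I)) \<le> 1 / 8"
          using I(1) by (simp add: card_Pow divide_le_eq)
        then have "(1 + real (card (H2 F)) / real (card (Pow I))) ^ (4 * u) \<le> (9 / 8) ^ (4 * u)"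
          by (intro power_mono) auto
        also have "(9 / 8 :: real) ^ (4 * u) = (6561 / 4096) ^ u"
          by (simp add: power_mult power_divide)
        also have "(6561 / 4096 :: real) ^ u = 2 * (6561 / 8192) ^ u * 2 ^ (u - 1)"
        proof -
          have "(2::real) ^ u = 2 * 2 ^ (u - 1)" using u(1) by (simp flip: power_Suc)
          moreover have "(6561 / 4096 :: real) ^ u = (6561 / 8192) ^ u * 2 ^ u"
            by (simp flip: power_mult_distrib)
          ultimately show ?thesis by simp
        qed
        finally show ?thesis
          unfolding F(1) w_def prod.case by (subst pos_divide_le_eq) auto
      qed
      have "sum w HH1 \<le> real (card HH1) * (2 ^ K * q ^ u)"
        by (rule sum_bounded_above) (rule w1)
      also have "\<dots> \<le> real (N ^ (k + 1)) * (2 ^ K * q ^ u)"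
        using order_trans[OF card_image_le[OF fA1] cA1] q
        by (intro mult_right_mono of_nat_mono) (auto simp: HH1_def)
      also have "\<dots> < 1 / 2" using elim(1)[folded N_def] by (simp add: mult_ac)
      finally have s1: "sum w HH1 < 1 / 2" .
      have "sum w HH2 \<le> real (card HH2) * (2 * (6561 / 8192) ^ u)"
        by (rule sum_bounded_above) (rule w2)
      also have "\<dots> \<le> real (N ^ (k * m)) * (2 * (6561 / 8192) ^ u)"
        using order_trans[OF card_image_le[OF fA2] cA2]
        by (intro mult_right_mono of_nat_mono) (auto simp: HH2_def)
      also have "\<dots> < 1 / 2" using elim(2)[folded N_def] by (simp add: mult_ac)
      finally have s2: "sum w HH2 < 1 / 2" .
      have fHH: "finite HH1" "finite HH2" using fA1 fA2 by (auto simp: HH1_def HH2_def)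
      have "0 \<le> sum w (HH1 \<inter> HH2)" by (intro sum_nonneg) (auto simp: w_def)
      then have "sum w (HH1 \<union> HH2) < 1"
        using sum.union_inter[OF fHH, of w] s1 s2 by linarith
      then have "\<exists>T \<in> {..<4 * u} \<rightarrow>\<^sub>E Pow I. \<forall>(H, s)\<in>HH1 \<union> HH2. card {c \<in> {..<4 * u}. T c \<in> H} < s"
        unfolding w_def using I(1) fHH
        by (intro exists_columns_avoiding) (auto simp: HH1_def HH2_def H1_def H2_def)
      then obtain T where T_Pow: "T \<in> {..<4 * u} \<rightarrow>\<^sub>E Pow I"
          and T_rare: "\<forall>(H, s)\<in>HH1 \<union> HH2. card {c \<in> {..<4 * u}. T c \<in> H} < s"
        by (rule bexE)
      have T: "card {c \<in> {..<4 * u}. T c \<in> H} < s" if "(H, s) \<in> HH1 \<union> HH2" for H s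
        using bspec[OF T_rare that] by simp
      have TI: "T c \<subseteq> I" if "c < 4 * u" for c using T_Pow that by auto
      show "\<exists>T. (\<forall>i\<in>I. \<forall>J. J \<subseteq> I - {i} \<longrightarrow> card J \<le> k \<longrightarrow>
            K \<le> card {c \<in> {..<4 * u}. separates (T c) i J}) \<and>
         (\<forall>F. disjoint F \<longrightarrow> \<Union>F \<subseteq> I \<longrightarrow> (\<forall>J\<in>F. card J \<le> k) \<longrightarrow> card F = m \<longrightarrow>
            card {c \<in> {..<4 * u}. (\<forall>J\<in>F. T c \<inter> J \<noteq> {}) \<or> (\<forall>J\<in>F. J - T c \<noteq> {})} \<le> u - 2)"
      proof (intro exI[of _ T] conjI ballI allI impI)
        fix i J assume iJ: "i \<in> I" "J \<subseteq> I - {i}" "card J \<le> k"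
        let ?Sep = "{c \<in> {..<4 * u}. separates (T c) i J}"
        have "card {c \<in> {..<4 * u}. T c \<in> H1 (i, J)} < 4 * u - K + 1"
          using iJ by (intro T) (auto simp: HH1_def A1_def)
        moreover have "{c \<in> {..<4 * u}. T c \<in> H1 (i, J)} = {..<4 * u} - ?Sep"
          using TI by (auto simp: H1_def)
        moreover have "card ({..<4 * u} - ?Sep) = 4 * u - card ?Sep"
          by (subst card_Diff_subset) auto
        ultimately have "4 * u - card ?Sep < 4 * u - K + 1" by simp
        then show "K \<le> card ?Sep" using u(2) by arith
      next
        fix F assume F: "disjoint F" "\<Union>F \<subseteq> I" "\<forall>J\<in>F. card J \<le> k" "card F = m"
        have "F \<in> A2" using F unfolding A2_def P_def by blast
        then have "card {c \<in> {..<4 * u}. T c \<in> H2 F} < u - 1"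
          unfolding HH2_def by (intro T[unfolded HH2_def] UnI2 imageI)
        moreover have "{c \<in> {..<4 * u}. T c \<in> H2 F}
            = {c \<in> {..<4 * u}. (\<forall>J\<in>F. T c \<inter> J \<noteq> {}) \<or> (\<forall>J\<in>F. J - T c \<noteq> {})}"
          using TI by (auto simp: H2_def)
        ultimately show "card {c \<in> {..<4 * u}. (\<forall>J\<in>F. T c \<inter> J \<noteq> {}) \<or> (\<forall>J\<in>F. J - T c \<noteq> {})} \<le> u - 2"
          by simp
      qed
    qed
  qed
qed

section \<open>Matchings, disjoint subfamilies and greedy colouring\<close>

text \<open>
  The elements are matched one at a time, using augmenting paths with at most three edges. If no free
  column is good for \<open>e\<close>, then its good columns are occupied by a set \<open>A\<close> of at least \<open>K\<close> elements.
  More than \<open>s\<close> columns are free, so one of them is good for some \<open>e' \<in> A\<close>; this \<open>e'\<close> moves there and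
  leaves its column to \<open>e\<close>.
\<close>
lemma matching_by_augmentation:
  fixes good :: "'b \<Rightarrow> 'c \<Rightarrow> bool"
  assumes "finite E" "finite C" "card E + s \<le> card C"
    and deg: "\<And>e. e \<in> E \<Longrightarrow> K \<le> card {c \<in> C. good e c}"
    and expand: "\<And>A. A \<subseteq> E \<Longrightarrow> K \<le> card A \<Longrightarrow> card {c \<in> C. \<forall>e\<in>A. \<not> good e c} \<le> s"
  shows "\<exists>g. inj_on g E \<and> (\<forall>e\<in>E. g e \<in> C \<and> good e (g e))"
proof -
  have "\<exists>g. inj_on g E' \<and> (\<forall>e\<in>E'. g e \<in> C \<and> good e (g e))" if "E' \<subseteq> E" for E'
    using finite_subset[OF that assms(1)] that
  proof (induction E' rule: finite_induct)
    case empty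
    then show ?case by simp
  next
    case (insert e E')
    then obtain g where g: "inj_on g E'" "\<forall>e\<in>E'. g e \<in> C \<and> good e (g e)" by auto
    let ?B = "C - g ` E'"
    show ?case
    proof (cases "\<exists>c\<in>?B. good e c")
      case True
      then obtain c where c: "c \<in> ?B" "good e c" by blast
      have "inj_on (g(e := c)) (insert e E')"
        unfolding inj_on_def using inj_onD[OF g(1)] c(1) insert.hyps(2) by auto
      moreover have "\<forall>e'\<in>insert e E'. (g(e := c)) e' \<in> C \<and> good e' ((g(e := c)) e')"
        using g(2) c by auto
      ultimately show ?thesis by blast
    next
      case False
      let ?A = "{e' \<in> E'. good e (g e')}"
      have "{c \<in> C. good e c} \<subseteq> g ` ?A" using False by auto
      then have "card {c \<in> C. good e c} \<le> card ?A"
        using insert.hyps(1) by (simp add: surj_card_le)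
      then have "K \<le> card ?A" using deg[of e] insert.prems by auto
      then have "card {c \<in> C. \<forall>e\<in>?A. \<not> good e c} \<le> s"
        using insert.prems by (intro expand) auto
      moreover have "s < card ?B"
      proof -
        have "card (insert e E') \<le> card E" using insert.prems assms(1) by (intro card_mono)
        then have "card E' < card E" using insert.hyps by simp
        moreover have "card (g ` E') \<le> card E'" by (rule card_image_le[OF insert.hyps(1)])
        moreover have "card C - card (g ` E') \<le> card ?B"
          using insert.hyps(1) by (simp add: diff_card_le_card_Diff)
        ultimately show ?thesis using assms(3) by linarith
      qed
      ultimately have "\<not> ?B \<subseteq> {c \<in> C. \<forall>e\<in>?A. \<not> good e c}"
        using assms(2) card_mono[of "{c \<in> C. \<forall>e\<in>?A. \<not> good e c}" ?B] by auto
      then obtain c e' where c: "c \<in> ?B" "e' \<in> E'" "good e (g e')" "good e' c"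
        by blast
      have ne: "e \<noteq> e'" using c insert.hyps by auto
      have "inj_on (g(e := g e', e' := c)) (insert e E')"
        unfolding inj_on_def using inj_onD[OF g(1)] c(1,2) insert.hyps(2) by auto
      moreover have "\<forall>f\<in>insert e E'. (g(e := g e', e' := c)) f \<in> C \<and> good f ((g(e := g e', e' := c)) f)"
        using g(2) c ne by auto
      ultimately show ?thesis by blast
    qed
  qed
  then show ?thesis by blast
qed

text \<open>
  Greedy choice: a chosen set excludes itself and, through each of its at most \<open>k\<close> points, at most
  \<open>t\<close> sets.
\<close>
lemma exists_disjoint_subfamily:
  assumes "finite A" "\<And>J. J \<in> A \<Longrightarrow> finite J \<and> card J \<le> k"
    and "\<And>i. card {J \<in> A. i \<in> J} \<le> t" "m * (k * t + 1) \<le> card A"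
  shows "\<exists>B \<subseteq> A. card B = m \<and> disjoint B"
  using assms
proof (induction m arbitrary: A)
  case 0
  show ?case by (intro exI[of _ "{}"]) (simp add: disjoint_def)
next
  case (Suc m)
  have "A \<noteq> {}" using Suc.prems(4) by auto
  then obtain J where J: "J \<in> A" by blast
  let ?M = "\<Union>i\<in>J. {J' \<in> A. i \<in> J'}"
  let ?A = "A - insert J ?M"
  have "card ?M \<le> (\<Sum>i\<in>J. card {J' \<in> A. i \<in> J'})"
    using Suc.prems(2)[OF J] by (intro card_UN_le) auto
  also have "\<dots> \<le> (\<Sum>i\<in>J. t)" by (intro sum_mono Suc.prems(3))
  also have "\<dots> \<le> k * t" using Suc.prems(2)[OF J] by simp
  finally have "card (insert J ?M) \<le> k * t + 1"
    using card_insert_le_m1[of "Suc (k * t)" ?M J] by simp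
  moreover have "card A - card (insert J ?M) \<le> card ?A"
    using Suc.prems(1) Suc.prems(2)[OF J] by (intro diff_card_le_card_Diff) auto
  ultimately have large: "m * (k * t + 1) \<le> card ?A"
    using Suc.prems(4) by simp
  have codeg: "card {J' \<in> ?A. i \<in> J'} \<le> t" for i
    by (rule order_trans[OF card_mono Suc.prems(3)[of i]]) (use Suc.prems(1) in auto)
  have fin: "finite ?A" using Suc.prems(1) by blast
  have small: "finite J' \<and> card J' \<le> k" if "J' \<in> ?A" for J' using that Suc.prems(2) by blast
  obtain B where B: "B \<subseteq> ?A" "card B = m" "disjoint B"
    using Suc.IH[OF fin small codeg large] by blast
  have "finite B" using B Suc.prems(1) finite_subset by blast
  moreover have "J \<notin> B" using B(1) by blast
  moreover have "J \<inter> J' = {}" if "J' \<in> B" for J' using B(1) that by blast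
  ultimately have "card (insert J B) = Suc m" and "disjoint (insert J B)"
    using B(2,3) by (simp_all add: disjoint_def Int_commute)
  moreover have "insert J B \<subseteq> A" using J B(1) by blast
  ultimately show ?case by blast
qed

lemma greedy_colouring:
  assumes "finite X" "\<And>x y. R x y \<Longrightarrow> R y x" "\<And>x. x \<in> X \<Longrightarrow> card {y \<in> X. R x y} \<le> d"
  shows "\<exists>\<phi>. \<phi> ` X \<subseteq> {..d::nat} \<and> (\<forall>x\<in>X. \<forall>y\<in>X. x \<noteq> y \<longrightarrow> R x y \<longrightarrow> \<phi> x \<noteq> \<phi> y)"
  using assms(1,3)
proof (induction X rule: finite_induct)
  case empty
  then show ?case by auto
next
  case (insert z X)
  have "card {y \<in> X. R x y} \<le> d" if "x \<in> X" for x
    by (rule order_trans[OF card_mono insert.prems[of x]]) (use that insert.hyps in auto)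
  then obtain \<phi> where \<phi>: "\<phi> ` X \<subseteq> {..d}" "\<forall>x\<in>X. \<forall>y\<in>X. x \<noteq> y \<longrightarrow> R x y \<longrightarrow> \<phi> x \<noteq> \<phi> y"
    using insert.IH by blast
  let ?U = "\<phi> ` {y \<in> X. R z y}"
  have "card ?U \<le> card {y \<in> X. R z y}" using insert.hyps by (intro card_image_le) auto
  also have "\<dots> \<le> card {y \<in> insert z X. R z y}" using insert.hyps by (intro card_mono) auto
  also have "\<dots> \<le> d" using insert.prems by simp
  finally have "\<not> {..d} \<subseteq> ?U"
    using card_mono[of ?U "{..d}"] insert.hyps by auto
  then obtain c where c: "c \<le> d" "c \<notin> ?U" by auto
  have "(\<phi>(z := c)) ` insert z X \<subseteq> {..d}" using \<phi>(1) c(1) by auto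
  moreover have "(\<phi>(z := c)) x \<noteq> (\<phi>(z := c)) y"
    if xy: "x \<in> insert z X" "y \<in> insert z X" "x \<noteq> y" "R x y" for x y
  proof -
    consider "x = z" "y \<in> X" "y \<noteq> z" | "y = z" "x \<in> X" "x \<noteq> z" | "x \<in> X" "y \<in> X" "x \<noteq> z" "y \<noteq> z"
      using xy(1-3) by blast
    then show ?thesis
      using \<phi>(2) c(2) xy(3,4) assms(2)[OF xy(4)] by cases auto
  qed
  ultimately show ?case by blast
qed

section \<open>Colouring the incidences\<close>

text \<open>
  The matching problem at a vertex \<open>x\<close>. Its expansion condition comes from \<open>m\<close> edges in \<open>A\<close> whose type
  sets without \<open>x\<close> are disjoint: a column inadmissible for all of \<open>A\<close> meets all of these type sets if
  it contains the type of \<open>x\<close>, and contains none of them otherwise.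
\<close>
lemma edge_palette:
  fixes \<phi> :: "'a \<Rightarrow> nat"
  assumes finS: "finite S" and finE: "\<And>s. s \<in> S \<Longrightarrow> finite s" and rank: "\<And>s. s \<in> S \<Longrightarrow> card s \<le> k"
    and codeg: "\<And>y. y \<noteq> x \<Longrightarrow> card {s \<in> S. {x, y} \<subseteq> s} \<le> t"
    and deg: "card {s \<in> S. x \<in> s} \<le> 3 * u + 2" and u: "2 \<le> u"
    and inj: "inj_on \<phi> (insert x (\<Union>{s \<in> S. x \<in> s}))" and ran: "\<phi> ` insert x (\<Union>{s \<in> S. x \<in> s}) \<subseteq> I"
    and sep: "\<And>i J. i \<in> I \<Longrightarrow> J \<subseteq> I - {i} \<Longrightarrow> card J \<le> k \<Longrightarrow>
        m * (k * t + 1) \<le> card {c \<in> {..<4 * u}. separates (T c) i J}"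
    and scatter: "\<And>F. disjoint F \<Longrightarrow> \<Union>F \<subseteq> I \<Longrightarrow> (\<forall>J\<in>F. card J \<le> k) \<Longrightarrow> card F = m \<Longrightarrow>
        card {c \<in> {..<4 * u}. (\<forall>J\<in>F. T c \<inter> J \<noteq> {}) \<or> (\<forall>J\<in>F. J - T c \<noteq> {})} \<le> u - 2"
  shows "\<exists>g. inj_on g {s \<in> S. x \<in> s} \<and>
    (\<forall>s\<in>{s \<in> S. x \<in> s}. g s \<in> {..<4 * u} \<and> separates (T (g s)) (\<phi> x) (\<phi> ` (s - {x})))"
proof (rule matching_by_augmentation[where s = "u - 2" and K = "m * (k * t + 1)"])
  let ?E = "{s \<in> S. x \<in> s}"
  let ?N = "insert x (\<Union>?E)"
  let ?J = "\<lambda>s. \<phi> ` (s - {x})"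
  have inN: "s \<subseteq> ?N" if "s \<in> ?E" for s using that by auto
  have J: "?J s \<subseteq> I - {\<phi> x}" "card (?J s) \<le> k" "finite (?J s)" if s: "s \<in> ?E" for s
  proof -
    show "?J s \<subseteq> I - {\<phi> x}"
    proof
      fix i assume "i \<in> ?J s"
      then obtain y where y: "y \<in> s" "y \<noteq> x" "i = \<phi> y" by blast
      then have "y \<in> ?N" using inN[OF s] by blast
      then show "i \<in> I - {\<phi> x}"
        using ran y inj_onD[OF inj, of y x] by auto
    qed
    have fs: "finite s" using s finE by auto
    have "card (?J s) \<le> card (s - {x})" using fs by (intro card_image_le) auto
    also have "\<dots> \<le> k" using fs rank[of s] s card_Diff1_le[of s x] by auto
    finally show "card (?J s) \<le> k" .
    show "finite (?J s)" using fs by simp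
  qed
  show "finite ?E" using finS by simp
  show "finite {..<4 * u}" by simp
  show "card ?E + (u - 2) \<le> card {..<4 * u}" using deg u by simp
  show "m * (k * t + 1) \<le> card {c \<in> {..<4 * u}. separates (T c) (\<phi> x) (?J s)}" if s: "s \<in> ?E" for s
    using J[OF s] ran by (intro sep) auto
  fix A assume A: "A \<subseteq> ?E" "m * (k * t + 1) \<le> card A"
  have injJ: "inj_on ?J A"
  proof (rule inj_onI)
    fix s s' assume s: "s \<in> A" "s' \<in> A" "?J s = ?J s'"
    then have "s \<in> ?E" "s' \<in> ?E" using A(1) by auto
    then have "s - {x} \<subseteq> ?N" "s' - {x} \<subseteq> ?N" using inN by blast+
    then have "s - {x} = s' - {x}" using inj_on_image_eq_iff[OF inj] s(3) by blast
    then show "s = s'" using \<open>s \<in> ?E\<close> \<open>s' \<in> ?E\<close> by blast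
  qed
  have fA: "finite A" using A(1) finS finite_subset by fastforce
  have "card {J \<in> ?J ` A. i \<in> J} \<le> t" for i
  proof (cases "\<exists>y. y \<in> ?N \<and> y \<noteq> x \<and> i = \<phi> y")
    case True
    then obtain y where y: "y \<in> ?N" "y \<noteq> x" "i = \<phi> y" by blast
    have "{J \<in> ?J ` A. i \<in> J} \<subseteq> ?J ` {s \<in> S. {x, y} \<subseteq> s}"
    proof
      fix J assume "J \<in> {J \<in> ?J ` A. i \<in> J}"
      then obtain s where s: "s \<in> A" "J = ?J s" "i \<in> ?J s" by blast
      then obtain z where z: "z \<in> s" "i = \<phi> z" by blast
      have "s \<in> ?E" using s(1) A(1) by auto
      then have zN: "z \<in> ?N" using z(1) by blast
      have "\<phi> z = \<phi> y" using z(2) y(3) by simp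
      then have "z = y" using zN y(1) by (rule inj_onD[OF inj])
      then show "J \<in> ?J ` {s \<in> S. {x, y} \<subseteq> s}" using s z \<open>s \<in> ?E\<close> by blast
    qed
    then have "card {J \<in> ?J ` A. i \<in> J} \<le> card {s \<in> S. {x, y} \<subseteq> s}"
      using finS by (intro surj_card_le) auto
    then show ?thesis using codeg[OF y(2)] by simp
  next
    case False
    have "{J \<in> ?J ` A. i \<in> J} = {}"
    proof (rule ccontr)
      assume "{J \<in> ?J ` A. i \<in> J} \<noteq> {}"
      then obtain s z where "s \<in> A" "z \<in> s - {x}" "i = \<phi> z" by blast
      then show False using False A(1) by auto
    qed
    then show ?thesis by (simp only: card.empty le0)
  qed
  moreover have "finite J \<and> card J \<le> k" if "J \<in> ?J ` A" for J
    using that J A(1) by auto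
  moreover have "m * (k * t + 1) \<le> card (?J ` A)"
    using A(2) injJ by (simp add: card_image)
  ultimately obtain B where B: "B \<subseteq> ?J ` A" "card B = m" "disjoint B"
    using exists_disjoint_subfamily[of "?J ` A" k t m] fA by blast
  have "card {c \<in> {..<4 * u}. \<forall>s\<in>A. \<not> separates (T c) (\<phi> x) (?J s)}
      \<le> card {c \<in> {..<4 * u}. (\<forall>J\<in>B. T c \<inter> J \<noteq> {}) \<or> (\<forall>J\<in>B. J - T c \<noteq> {})}"
  proof (rule card_mono)
    show "{c \<in> {..<4 * u}. \<forall>s\<in>A. \<not> separates (T c) (\<phi> x) (?J s)}
      \<subseteq> {c \<in> {..<4 * u}. (\<forall>J\<in>B. T c \<inter> J \<noteq> {}) \<or> (\<forall>J\<in>B. J - T c \<noteq> {})}"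
    proof
      fix c assume "c \<in> {c \<in> {..<4 * u}. \<forall>s\<in>A. \<not> separates (T c) (\<phi> x) (?J s)}"
      then have c: "c \<in> {..<4 * u}" and bad: "\<forall>s\<in>A. \<not> separates (T c) (\<phi> x) (?J s)"
        by blast+
      have nsep: "\<not> separates (T c) (\<phi> x) J" if "J \<in> B" for J
        using that bad B(1) by blast
      show "c \<in> {c \<in> {..<4 * u}. (\<forall>J\<in>B. T c \<inter> J \<noteq> {}) \<or> (\<forall>J\<in>B. J - T c \<noteq> {})}"
        using c nsep unfolding separates_def by blast
    qed
  qed simp
  also have "\<dots> \<le> u - 2"
  proof (rule scatter)
    have "J' \<subseteq> I \<and> card J' \<le> k" if J': "J' \<in> B" for J'
    proof -
      obtain s where s: "s \<in> A" "J' = ?J s" using J' B(1) by blast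
      then have "s \<in> ?E" using A(1) by blast
      then show ?thesis using J(1,2)[of s] s(2) by auto
    qed
    then show "\<Union>B \<subseteq> I" "\<forall>J\<in>B. card J \<le> k" by blast+
  qed (use B in auto)
  finally show "card {c \<in> {..<4 * u}. \<forall>s\<in>A. \<not> separates (T c) (\<phi> x) (?J s)} \<le> u - 2" .
qed

text \<open>
  Column \<open>c\<close> with bit \<open>b\<close> becomes the colour \<open>1 + 2 * c + b\<close>.
\<close>
lemma incidence_chromatic_number_le_of_palette:
  assumes g: "\<And>x. x \<in> X \<Longrightarrow> inj_on (g x) {s \<in> S. x \<in> s}"
    and good: "\<And>x s. x \<in> X \<Longrightarrow> s \<in> S \<Longrightarrow> x \<in> s \<Longrightarrow>
        g x s < n \<and> separates (T (g x s)) (\<phi> x) (\<phi> ` (s - {x}))"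
  shows "incidence_chromatic_number X S \<le> 2 * n"
proof -
  define col where "col = (\<lambda>(x, s). 1 + (2 * g x s + (if \<phi> x \<in> T (g x s) then 1 else 0)))"
  have eqD: "g x s = g x' s' \<and> (\<phi> x \<in> T (g x s) \<longleftrightarrow> \<phi> x' \<in> T (g x s))"
    if "col (x, s) = col (x', s')" for x s x' s'
  proof -
    have "g x s = g x' s'" using that by (auto simp: col_def split: if_splits; presburger)
    then show ?thesis using that by (auto simp: col_def split: if_splits)
  qed
  have clash: False
    if "x \<in> X" "s \<in> S" "x \<in> s" "x' \<in> s" "x \<noteq> x'" "\<phi> x \<in> T (g x s) \<longleftrightarrow> \<phi> x' \<in> T (g x s)" for x x' s
    using good[OF that(1-3)] that(4-6) unfolding separates_def by auto
  have "proper_incidence_coloring X S (2 * n) col"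
    unfolding proper_incidence_coloring_def
  proof (intro conjI ballI impI)
    show "col ` incidences X S \<subseteq> {1..2 * n}"
    proof safe
      fix x s assume "(x, s) \<in> incidences X S"
      then have "g x s < n" using good by (auto simp: incidences_def)
      then show "col (x, s) \<in> {1..2 * n}" by (auto simp: col_def)
    qed
    fix i j assume ij: "i \<in> incidences X S" "j \<in> incidences X S" "incidence_adj i j"
    obtain x s x' s' where eq: "i = (x, s)" "j = (x', s')" by force
    have x: "x \<in> X" "s \<in> S" "x \<in> s" "x' \<in> X" "s' \<in> S" "x' \<in> s'"
      using ij(1,2) by (auto simp: eq incidences_def)
    show "col i \<noteq> col j"
    proof
      assume "col i = col j"
      then have c: "g x s = g x' s'" "\<phi> x \<in> T (g x s) \<longleftrightarrow> \<phi> x' \<in> T (g x s)"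
        using eqD[of x s x' s'] unfolding eq by blast+
      show False
      proof (cases "x = x'")
        case True
        then have "s = s'" using inj_onD[OF g[OF x(1)]] c(1) x by auto
        then show False using True ij(3) by (simp add: eq)
      next
        case False
        then have "x' \<in> s \<or> x \<in> s'" using ij(3) by (auto simp: eq)
        then show False
          using clash[of x s x'] clash[of x' s' x] x c False by auto
      qed
    qed
  qed
  then show ?thesis
    unfolding incidence_chromatic_number_def by (intro Least_le) blast
qed

text \<open>
  The types come from a greedy colouring of the graph that joins two vertices with a common
  neighbour, where the neighbourhood \<open>N x\<close> is the union of the edges at \<open>x\<close> and has at most
  \<open>k * (3 * u + 2)\<close> elements.
\<close>
lemma incidence_chromatic_number_le_degree:
  "\<exists>D. \<forall>(X :: 'a set) S. hypergraph X S \<and> quasi_linear t X S \<and> edge_rank S \<le> k \<and> max_degree X S \<ge> D \<longrightarrow>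
     incidence_chromatic_number X S \<le> 8 * (max_degree X S div 3)"
proof -
  have "(\<lambda>m. 2 * (1 - 1 / 2 ^ k) ^ m :: real) \<longlonglongrightarrow> 2 * 0"
  proof (intro tendsto_mult tendsto_const LIMSEQ_power_zero)
    have "(1::real) \<le> 2 ^ k" by (rule one_le_power) simp
    then have "1 / 2 ^ k \<le> (1::real)" "0 < 1 / (2::real) ^ k" by (simp_all add: divide_le_eq)
    then show "norm (1 - 1 / 2 ^ k :: real) < 1" by simp
  qed
  then have "\<forall>\<^sub>F m in sequentially. 2 * (1 - 1 / 2 ^ k) ^ m < (1 / 8 :: real)"
    by (rule order_tendstoD(2)) simp
  \<comment> \<open>the constant \<open>m\<close> depends only on \<open>k\<close>; then \<open>m * (k * t + 1)\<close> edges at a vertex contain \<open>m\<close> edges that are otherwise disjoint\<close>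
  then obtain m where m: "2 * (1 - 1 / 2 ^ k) ^ m \<le> (1 / 8 :: real)"
    by (meson eventually_sequentially less_imp_le order_refl)
  obtain u0 where "\<forall>u\<ge>u0. \<forall>I :: nat set. finite I \<and> card I \<le> (k * (3 * u + 2))\<^sup>2 + 1 \<longrightarrow>
    (\<exists>T. (\<forall>i\<in>I. \<forall>J. J \<subseteq> I - {i} \<longrightarrow> card J \<le> k \<longrightarrow>
            m * (k * t + 1) \<le> card {c \<in> {..<4 * u}. separates (T c) i J}) \<and>
         (\<forall>F. disjoint F \<longrightarrow> \<Union>F \<subseteq> I \<longrightarrow> (\<forall>J\<in>F. card J \<le> k) \<longrightarrow> card F = m \<longrightarrow>
            card {c \<in> {..<4 * u}. (\<forall>J\<in>F. T c \<inter> J \<noteq> {}) \<or> (\<forall>J\<in>F. J - T c \<noteq> {})} \<le> u - 2))"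
    using eventually_exists_separating_columns[OF m, of "m * (k * t + 1)"]
    unfolding eventually_sequentially by (rule exE)
  note u0 = this[rule_format]
  show ?thesis
  proof (intro exI[of _ "3 * (u0 + 2)"] allI impI, elim conjE)
    fix X :: "'a set" and S
    assume H: "hypergraph X S" and ql: "quasi_linear t X S" and rk: "edge_rank S \<le> k"
      and D: "3 * (u0 + 2) \<le> max_degree X S"
    interpret hypergraph X S by (rule H)
    define u where "u = max_degree X S div 3"
    have u: "u0 \<le> u" "2 \<le> u" and Du: "max_degree X S \<le> 3 * u + 2"
      using D by (auto simp: u_def)
    have finS: "finite S"
      using finite_subset[of S "Pow X"] edges_subset finite_vertices by auto
    have finE: "finite s" if "s \<in> S" for s
      using edges_subset[OF that] finite_vertices finite_subset by blast
    have card_edge: "card s \<le> k" if "s \<in> S" for s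
    proof -
      have "card s \<le> edge_rank S" unfolding edge_rank_def using finS that by (intro Max_ge) auto
      then show ?thesis using rk by simp
    qed
    have deg: "card {s \<in> S. x \<in> s} \<le> 3 * u + 2" for x
    proof (cases "x \<in> X")
      case True
      then have "vertex_degree S x \<le> max_degree X S"
        unfolding max_degree_def using finite_vertices by (intro Max_ge) auto
      then show ?thesis using Du by (simp add: vertex_degree_def)
    next
      case False
      then have "{s \<in> S. x \<in> s} = {}" using edges_subset by blast
      then show ?thesis by (simp only: card.empty le0)
    qed
    \<comment> \<open>the sets \<open>N x\<close> are symmetric, \<open>y \<in> N x\<close> iff \<open>x \<in> N y\<close>, so a vertex with a common neighbour of \<open>x\<close> is found in two steps\<close>
    define N where "N = (\<lambda>x. \<Union>{s \<in> S. x \<in> s})"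
    have finN: "finite (N x)" for x using finS finE by (auto simp: N_def)
    have cardN: "card (N x) \<le> k * (3 * u + 2)" for x
    proof -
      have "card (N x) \<le> (\<Sum>s\<in>{s \<in> S. x \<in> s}. card s)"
        unfolding N_def by (rule card_Union_le_sum_card)
      also have "\<dots> \<le> card {s \<in> S. x \<in> s} * k"
        using sum_bounded_above[of "{s \<in> S. x \<in> s}" card k] card_edge by simp
      also have "\<dots> \<le> (3 * u + 2) * k" using deg by (rule mult_right_mono) simp
      finally show ?thesis by (simp add: mult.commute)
    qed
    define R where "R = (\<lambda>x y. \<exists>z. x \<in> N z \<and> y \<in> N z)"
    have symR: "R x y \<Longrightarrow> R y x" for x y by (auto simp: R_def)
    have cardR: "card {y \<in> X. R x y} \<le> (k * (3 * u + 2))\<^sup>2" for x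
    proof -
      have "{y \<in> X. R x y} \<subseteq> (\<Union>z\<in>N x. N z)" by (auto simp: R_def N_def)
      then have "card {y \<in> X. R x y} \<le> card (\<Union>z\<in>N x. N z)"
        using finN by (intro card_mono) auto
      also have "\<dots> \<le> (\<Sum>z\<in>N x. card (N z))" by (rule card_UN_le[OF finN])
      also have "\<dots> \<le> card (N x) * (k * (3 * u + 2))"
        using sum_bounded_above[of "N x" "\<lambda>z. card (N z)"] cardN by simp
      also have "\<dots> \<le> (k * (3 * u + 2)) * (k * (3 * u + 2))" using cardN by (rule mult_right_mono) simp
      finally show ?thesis by (simp add: power2_eq_square)
    qed
    have "\<exists>\<phi>. \<phi> ` X \<subseteq> {..(k * (3 * u + 2))\<^sup>2} \<and>
        (\<forall>x\<in>X. \<forall>y\<in>X. x \<noteq> y \<longrightarrow> R x y \<longrightarrow> \<phi> x \<noteq> \<phi> y)"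
      by (rule greedy_colouring[OF finite_vertices], erule symR, rule cardR)
    then obtain \<phi> where \<phi>: "\<phi> ` X \<subseteq> {..(k * (3 * u + 2))\<^sup>2}"
        and \<phi>R: "\<forall>x\<in>X. \<forall>y\<in>X. x \<noteq> y \<longrightarrow> R x y \<longrightarrow> \<phi> x \<noteq> \<phi> y"
      by (elim exE conjE)
    let ?I = "{..(k * (3 * u + 2))\<^sup>2}"
    obtain T where T_sep: "\<forall>i\<in>?I. \<forall>J. J \<subseteq> ?I - {i} \<longrightarrow> card J \<le> k \<longrightarrow>
            m * (k * t + 1) \<le> card {c \<in> {..<4 * u}. separates (T c) i J}"
        and T_scatter: "\<forall>F. disjoint F \<longrightarrow> \<Union>F \<subseteq> ?I \<longrightarrow> (\<forall>J\<in>F. card J \<le> k) \<longrightarrow> card F = m \<longrightarrow>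
            card {c \<in> {..<4 * u}. (\<forall>J\<in>F. T c \<inter> J \<noteq> {}) \<or> (\<forall>J\<in>F. J - T c \<noteq> {})} \<le> u - 2"
    proof -
      have "finite ?I \<and> card ?I \<le> (k * (3 * u + 2))\<^sup>2 + 1" by simp
      from u0[OF u(1) this] show ?thesis by (elim exE conjE) (rule that)
    qed
    have "\<exists>g. inj_on g {s \<in> S. x \<in> s} \<and>
      (\<forall>s\<in>{s \<in> S. x \<in> s}. g s \<in> {..<4 * u} \<and> separates (T (g s)) (\<phi> x) (\<phi> ` (s - {x})))"
      if "x \<in> X" for x
    proof (rule edge_palette[where I = ?I and k = k and m = m and t = t])
      have NX: "insert x (N x) \<subseteq> X" using that edges_subset by (auto simp: N_def)
      have RN: "R y z" if "y \<in> insert x (N x)" "z \<in> insert x (N x)" "y \<noteq> z" for y z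
        using that unfolding R_def N_def by blast
      have "inj_on \<phi> (insert x (N x))"
      proof (rule inj_onI)
        fix y z assume yz: "y \<in> insert x (N x)" "z \<in> insert x (N x)" "\<phi> y = \<phi> z"
        show "y = z"
        proof (rule ccontr)
          assume "y \<noteq> z"
          moreover have "y \<in> X" "z \<in> X" using yz NX by blast+
          ultimately show False using \<phi>R RN[OF yz(1,2)] yz(3) by blast
        qed
      qed
      then show "inj_on \<phi> (insert x (\<Union>{s \<in> S. x \<in> s}))" by (simp only: N_def)
      have "\<phi> ` insert x (N x) \<subseteq> ?I" using \<phi> NX by blast
      then show "\<phi> ` insert x (\<Union>{s \<in> S. x \<in> s}) \<subseteq> ?I" by (simp only: N_def)
      fix y assume "y \<noteq> x"
      show "card {s \<in> S. {x, y} \<subseteq> s} \<le> t"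
      proof (cases "y \<in> X")
        case True
        then show ?thesis using ql \<open>x \<in> X\<close> \<open>y \<noteq> x\<close> unfolding quasi_linear_def by metis
      next
        case False
        then have "{s \<in> S. {x, y} \<subseteq> s} = {}" using edges_subset by blast
        then show ?thesis by (simp only: card.empty le0)
      qed
    next
      show "m * (k * t + 1) \<le> card {c \<in> {..<4 * u}. separates (T c) i J}"
        if "i \<in> ?I" "J \<subseteq> ?I - {i}" "card J \<le> k" for i J
        using T_sep that by blast
      show "card {c \<in> {..<4 * u}. (\<forall>J\<in>F. T c \<inter> J \<noteq> {}) \<or> (\<forall>J\<in>F. J - T c \<noteq> {})} \<le> u - 2"
        if "disjoint F" "\<Union>F \<subseteq> ?I" "\<forall>J\<in>F. card J \<le> k" "card F = m" for F
        using T_scatter that by blast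
    qed (fact finS finE card_edge deg u(2))+
    then have "\<forall>x\<in>X. \<exists>g. inj_on g {s \<in> S. x \<in> s} \<and>
      (\<forall>s\<in>{s \<in> S. x \<in> s}. g s \<in> {..<4 * u} \<and> separates (T (g s)) (\<phi> x) (\<phi> ` (s - {x})))"
      by blast
    then obtain g where g: "\<forall>x\<in>X. inj_on (g x) {s \<in> S. x \<in> s} \<and>
      (\<forall>s\<in>{s \<in> S. x \<in> s}. g x s \<in> {..<4 * u} \<and> separates (T (g x s)) (\<phi> x) (\<phi> ` (s - {x})))"
      by (rule bchoice[THEN exE])
    have "incidence_chromatic_number X S \<le> 2 * (4 * u)"
      by (rule incidence_chromatic_number_le_of_palette[of X g S "4 * u" T \<phi>]) (use g in auto)
    then show "incidence_chromatic_number X S \<le> 8 * (max_degree X S div 3)"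
      by (simp add: u_def)
  qed
qed

section \<open>Comparison with the stated bounds\<close>

text \<open>
  Dropping the nonnegative power, \<open>W k t * k \<ge> k + t \<ge> 3\<close>, because \<open>(2 * k - 1)\<^sup>2 \<le> (4 * k - 3) * k\<close>.
\<close>
lemma mult_W_ge:
  assumes "0 < t" "t < k"
  shows "8 / 3 \<le> W k t * real k"
proof -
  let ?a = "(4 * real k - 3) * real t / (2 * real k - 1)\<^sup>2"
  have k: "real k \<ge> 2" and t: "real t \<ge> 1" using assms by auto
  have pos: "(2 * real k - 1)\<^sup>2 > 0" using k by simp
  have "(2 * real k - 1)\<^sup>2 \<le> (4 * real k - 3) * real k"
    using k by (simp add: power2_eq_square algebra_simps)
  also have "\<dots> \<le> (4 * real k - 3) * real t * real k"
  proof -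
    have "(4 * real k - 3) * 1 \<le> (4 * real k - 3) * real t" using k t by (intro mult_left_mono) auto
    then show ?thesis using k by (simp add: mult_right_mono)
  qed
  finally have "1 \<le> ?a * real k"
    using pos by (simp add: le_divide_eq)
  then have "3 \<le> (1 + ?a) * real k" using k by (simp only: distrib_right mult_1_left)
  also have "\<dots> \<le> W k t * real k"
    unfolding W_def by (intro mult_right_mono) auto
  finally show ?thesis by simp
qed

theorem theorem4p3:
  "(\<forall>k t :: nat. 0 < t \<and> t < k \<longrightarrow>
      (\<exists>D :: nat. \<forall>(X :: 'a set) S.
         hypergraph X S \<and> quasi_linear t X S \<and> edge_rank S = k \<and> max_degree X S \<ge> D \<longrightarrow>
         real (incidence_chromatic_number X S)
           \<le> W k t * real (edge_rank S) * real (max_degree X S))) \<and>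
   (\<forall>\<epsilon> :: real. \<epsilon> > 0 \<longrightarrow>
      (\<exists>\<eta> :: real. \<eta> > 0 \<and>
         (\<forall>t k :: nat. 0 < t \<and> 0 < k \<and> real t \<le> \<eta> * real k \<longrightarrow>
            (\<exists>D' :: nat. \<forall>(X :: 'a set) S.
               hypergraph X S \<and> quasi_linear t X S \<and> edge_rank S = k \<and> max_degree X S \<ge> D' \<longrightarrow>
               real (incidence_chromatic_number X S)
                 \<le> (4 / 3 + \<epsilon>) * real (edge_rank S) * real (max_degree X S)))))"
proof -
  have bound: "\<exists>D. \<forall>(X :: 'a set) S. hypergraph X S \<and> quasi_linear t X S \<and> edge_rank S = k \<and> max_degree X S \<ge> D \<longrightarrow>
      real (incidence_chromatic_number X S) \<le> r * real (edge_rank S) * real (max_degree X S)"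
    if r: "8 / 3 \<le> r * real k" for t k r
  proof -
    obtain D where D: "\<And>(X :: 'a set) S. hypergraph X S \<and> quasi_linear t X S \<and> edge_rank S \<le> k \<and> max_degree X S \<ge> D \<Longrightarrow>
        incidence_chromatic_number X S \<le> 8 * (max_degree X S div 3)"
      using incidence_chromatic_number_le_degree[of t k] by blast
    show ?thesis
    proof (intro exI[of _ D] allI impI)
      fix X :: "'a set" and S
      assume H: "hypergraph X S \<and> quasi_linear t X S \<and> edge_rank S = k \<and> max_degree X S \<ge> D"
      then have "incidence_chromatic_number X S \<le> 8 * (max_degree X S div 3)"
        by (intro D) auto
      then have "3 * incidence_chromatic_number X S \<le> 8 * max_degree X S" by linarith
      then have "real (incidence_chromatic_number X S) \<le> 8 / 3 * real (max_degree X S)" by linarith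
      also have "\<dots> \<le> r * real k * real (max_degree X S)" using r by (rule mult_right_mono) simp
      finally show "real (incidence_chromatic_number X S) \<le> r * real (edge_rank S) * real (max_degree X S)"
        using H by simp
    qed
  qed
  have "8 / 3 \<le> (4 / 3 + \<epsilon>) * real k"
    if "\<epsilon> > 0" "0 < t" "real t \<le> 1 / 2 * real k" for \<epsilon> :: real and t k
  proof -
    have "4 / 3 * 2 \<le> (4 / 3 + \<epsilon>) * real k" using that by (intro mult_mono) auto
    then show ?thesis by simp
  qed
  then show ?thesis
    using bound mult_W_ge by (intro conjI allI impI exI[of _ "1 / 2 :: real"]) auto
qed

end
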